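(* Let $K\ge2$, $\mu>0$, $0<\tau_0<1$ and $\alpha=\frac1{2\pi}\sqrt{2\ln(1/\tau_0)}$. Let $x(t)=\sum_{k=1}^K x_k(t)$ with $x_k(t)=A_k(t)e^{i2\pi\phi_k(t)}$, where $A_k(t)>0$, the $\phi_k$ are twice differentiable real functions with $\phi_1'(t)>0$ and $\phi'_{k-1}(t)<\phi'_k(t)$ for $2\le k\le K$, and each $x_k$ is a linear chirp or its adaptive CWT is well approximated by that of its local linear chirp, so that at time $b$ and with parameter $\sigma$ the time-scale zone of $x_k$ has lower and upper boundaries $l_k(b)$ and $u_k(b)$ as defined in the context. Let $\alpha_k(b),\beta_k(b),\gamma_k(b),\Upsilon_k(b)$ be as defined in the context. Suppose that for every $b$ with $|\phi_k''(b)|+|\phi_{k-1}''(b)|\neq0$ for $k=2,\dots,K$, $$4\alpha\sqrt{\pi}\,\sqrt{|\phi_k''(b)|+|\phi_{k-1}''(b)|}\le\phi_k'(b)-\phi_{k-1}'(b),\qquad k=2,\dots,K,$$ and $$\max\Big\{\frac\alpha\mu,\ \frac{\beta_k(b)-\sqrt{\Upsilon_k(b)}}{2\alpha_k(b)}:\ 2\le k\le K\Big\}\le\min_{2\le k\le K}\Big\{\frac{\beta_k(b)+\sqrt{\Upsilon_k(b)}}{2\alpha_k(b)}\Big\}.$$ Then the components of $x$ are well-separable in the time-scale plane, in the following sense. For every such $b$ there exists $\sigma=\sigma(b)\ge\frac\alpha\mu$ with $$\frac{\beta_k(b)-\sqrt{\Upsilon_k(b)}}{2\alpha_k(b)}\le\sigma\le\frac{\beta_k(b)+\sqrt{\Upsilon_k(b)}}{2\alpha_k(b)}\qquad\text{for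 all }k=2,\dots,K,$$ and for every such choice of $\sigma=\sigma(b)$ the time-scale zones of $x_1,\dots,x_K$ do not overlap, that is, $u_k(b)$ is well defined (real) and $$u_k(b)\le l_{k-1}(b),\qquad k=2,\dots,K .$$
   Context: The wavelet is $\psi_\sigma(t)=\frac1{\sigma\sqrt{2\pi}}e^{-\frac12(t/\sigma)^2}e^{i2\pi\mu t}$, with Fourier transform $\widehat\psi_\sigma(\xi)=e^{-2\pi^2\sigma^2(\xi-\mu)^2}$. The number $\tau_0$ is a threshold: the function $e^{-2\pi^2\xi^2}$ is regarded as vanishing where it is less than $\tau_0$, i.e. outside $[-\alpha,\alpha]$. It is always assumed that $\sigma\ge\alpha/\mu$. The adaptive CWT of $x_k$ with parameter $\sigma=\sigma(b)$ is $\widetilde W_{x_k}(a,b)=\int_{-\infty}^\infty x_k(b+at)\overline{\psi_{\sigma(b)}(t)}\,dt$, $a>0$. The local linear chirp approximation replaces it by $\int_{-\infty}^\infty A_k(b)e^{i2\pi(\phi_k(b)+\phi_k'(b)at+\frac12\phi_k''(b)(at)^2)}\overline{\psi_{\sigma(b)}(t)}\,dt$. Convention for time-scale zones: under this approximation $\widetilde W_{x_k}(\cdot,b)$ is regarded as lying in the zone $l_k(b)\le a\le u_k(b)$. Its boundaries are the solutions (the smaller positive root for $u_k$, the positive root for $l_k$) of $$\frac{\mu}{u_k}+\alpha\Big(\frac1{u_k\sigma}+2\pi|\phi_k''(b)|u_k\sigma\Big)=\phi_k'(b),\qquad \frac{\mu}{l_k}-\alpha\Big(\frac1{l_k\sigma}+2\pi|\phi_k''(b)|l_k\sigma\Big)=\phi_k'(b),$$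 namely $$u_k(b)=\frac{2(\mu+\frac\alpha\sigma)}{\phi_k'(b)+\sqrt{\phi_k'(b)^2-8\pi\alpha(\alpha+\mu\sigma)|\phi_k''(b)|}},\qquad l_k(b)=\frac{2(\mu-\frac\alpha\sigma)}{\phi_k'(b)+\sqrt{\phi_k'(b)^2+8\pi\alpha(\mu\sigma-\alpha)|\phi_k''(b)|}} .$$ Here $u_k(b)$ is well defined when the quantity under its square root is nonnegative. Zones are called non-overlapping when $u_k(b)\le l_{k-1}(b)$ for $k=2,\dots,K$. For $2\le k\le K$ define $$\alpha_k(b)=2\pi\alpha\mu\big(|\phi_k''(b)|+|\phi_{k-1}''(b)|\big)^2,$$ $$\beta_k(b)=\big(\phi_k'(b)|\phi_{k-1}''(b)|+\phi_{k-1}'(b)|\phi_k''(b)|\big)\big(\phi_k'(b)-\phi_{k-1}'(b)\big)+4\pi\alpha^2\big(\phi_k''(b)^2-\phi_{k-1}''(b)^2\big),$$ $$\gamma_k(b)=\frac\alpha\mu\Big\{\big(\phi_k'(b)|\phi_{k-1}''(b)|+\phi_{k-1}'(b)|\phi_k''(b)|\big)\big(\phi_k'(b)+\phi_{k-1}'(b)\big)+2\pi\alpha^2\big(|\phi_k''(b)|-|\phi_{k-1}''(b)|\big)^2\Big\},$$ $$\Upsilon_k(b)=\beta_k(b)^2-4\alpha_k(b)\gamma_k(b).$$ *)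

theory Defs
  imports "HOL-Analysis.Analysis"
begin

definition wavelet :: "real \<Rightarrow> real \<Rightarrow> real \<Rightarrow> complex" where
  "wavelet \<mu> \<sigma> t =
     of_real (1 / (\<sigma> * sqrt (2 * pi)) * exp (- (1/2) * (t / \<sigma>)\<^sup>2)) * cis (2 * pi * \<mu> * t)"

definition adaptive_cwt :: "real \<Rightarrow> (real \<Rightarrow> complex) \<Rightarrow> real \<Rightarrow> real \<Rightarrow> real \<Rightarrow> complex" where
  "adaptive_cwt \<mu> x \<sigma> b a = (LINT t|lborel. x (b + a * t) * cnj (wavelet \<mu> \<sigma> t))"

definition component :: "(real \<Rightarrow> real) \<Rightarrow> (real \<Rightarrow> real) \<Rightarrow> real \<Rightarrow> complex" where
  "component A \<phi> t = of_real (A t) * cis (2 * pi * \<phi> t)"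

definition local_chirp :: "(real \<Rightarrow> real) \<Rightarrow> (real \<Rightarrow> real) \<Rightarrow> real \<Rightarrow> real \<Rightarrow> complex" where
  "local_chirp A \<phi> b t = of_real (A b) *
     cis (2 * pi * (\<phi> b + deriv \<phi> b * (t - b) + (1/2) * deriv (deriv \<phi>) b * (t - b)\<^sup>2))"

definition is_linear_chirp :: "(real \<Rightarrow> real) \<Rightarrow> (real \<Rightarrow> real) \<Rightarrow> bool" where
  "is_linear_chirp A \<phi> \<longleftrightarrow>
     (\<exists>A0 d c r. \<forall>t. A t = A0 \<and> \<phi> t = d + c * t + (1/2) * r * t\<^sup>2)"

text \<open>
  In \<open>zone_upper\<close> and \<open>zone_lower\<close> the chirp rate enters only through its absolute value.
  Since \<open>sqrt\<close> is total on the reals, the well-definedness of the upper boundary is the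
  separate condition that \<open>upper_discr\<close> is nonnegative.
\<close>

definition upper_discr :: "real \<Rightarrow> real \<Rightarrow> (real \<Rightarrow> real) \<Rightarrow> real \<Rightarrow> real \<Rightarrow> real" where
  "upper_discr \<mu> \<alpha> \<phi> \<sigma> b =
     (deriv \<phi> b)\<^sup>2 - 8 * pi * \<alpha> * (\<alpha> + \<mu> * \<sigma>) * \<bar>deriv (deriv \<phi>) b\<bar>"

definition zone_upper :: "real \<Rightarrow> real \<Rightarrow> (real \<Rightarrow> real) \<Rightarrow> real \<Rightarrow> real \<Rightarrow> real" where
  "zone_upper \<mu> \<alpha> \<phi> \<sigma> b =
     2 * (\<mu> + \<alpha> / \<sigma>) / (deriv \<phi> b + sqrt (upper_discr \<mu> \<alpha> \<phi> \<sigma> b))"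

definition zone_lower :: "real \<Rightarrow> real \<Rightarrow> (real \<Rightarrow> real) \<Rightarrow> real \<Rightarrow> real \<Rightarrow> real" where
  "zone_lower \<mu> \<alpha> \<phi> \<sigma> b =
     2 * (\<mu> - \<alpha> / \<sigma>) /
     (deriv \<phi> b + sqrt ((deriv \<phi> b)\<^sup>2 + 8 * pi * \<alpha> * (\<mu> * \<sigma> - \<alpha>) * \<bar>deriv (deriv \<phi>) b\<bar>))"

text \<open>
  At \<open>b\<close>, write \<open>p\<close> for the first derivative of \<open>\<phi> k\<close> and \<open>r\<close> for the absolute value of its
  second derivative, \<open>q\<close> and \<open>s\<close> for those of \<open>\<phi> (k - 1)\<close>, and \<open>y = \<sigma> * l\<close> where \<open>l\<close> is the lower boundary of component \<open>k - 1\<close>. Then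
  \<open>\<mu> * \<sigma> = 2 * pi * \<alpha> * s * y\<^sup>2 + q * y + \<alpha>\<close>, and the upper boundary of component \<open>k\<close> equals \<open>l\<close>
  only if \<open>2 * pi * \<alpha> * (r + s) * y\<^sup>2 - (p - q) * y + 2 * \<alpha> = 0\<close>. Eliminating \<open>y\<close> yields
  \<open>sep_alpha * \<sigma>\<^sup>2 - sep_beta * \<sigma> + sep_gamma = 0\<close>, with roots \<open>sigma_lo\<close> and \<open>sigma_hi\<close>.
\<close>

definition sep_alpha :: "real \<Rightarrow> real \<Rightarrow> (nat \<Rightarrow> real \<Rightarrow> real) \<Rightarrow> nat \<Rightarrow> real \<Rightarrow> real" where
  "sep_alpha \<mu> \<alpha> \<phi> k b =
     2 * pi * \<alpha> * \<mu> * (\<bar>deriv (deriv (\<phi> k)) b\<bar> + \<bar>deriv (deriv (\<phi> (k - 1))) b\<bar>)\<^sup>2"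

definition sep_beta :: "real \<Rightarrow> (nat \<Rightarrow> real \<Rightarrow> real) \<Rightarrow> nat \<Rightarrow> real \<Rightarrow> real" where
  "sep_beta \<alpha> \<phi> k b =
     (deriv (\<phi> k) b * \<bar>deriv (deriv (\<phi> (k - 1))) b\<bar>
        + deriv (\<phi> (k - 1)) b * \<bar>deriv (deriv (\<phi> k)) b\<bar>)
       * (deriv (\<phi> k) b - deriv (\<phi> (k - 1)) b)
     + 4 * pi * \<alpha>\<^sup>2 * ((deriv (deriv (\<phi> k)) b)\<^sup>2 - (deriv (deriv (\<phi> (k - 1))) b)\<^sup>2)"

definition sep_gamma :: "real \<Rightarrow> real \<Rightarrow> (nat \<Rightarrow> real \<Rightarrow> real) \<Rightarrow> nat \<Rightarrow> real \<Rightarrow> real" where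
  "sep_gamma \<mu> \<alpha> \<phi> k b = \<alpha> / \<mu> *
     ((deriv (\<phi> k) b * \<bar>deriv (deriv (\<phi> (k - 1))) b\<bar>
         + deriv (\<phi> (k - 1)) b * \<bar>deriv (deriv (\<phi> k)) b\<bar>)
        * (deriv (\<phi> k) b + deriv (\<phi> (k - 1)) b)
      + 2 * pi * \<alpha>\<^sup>2 * (\<bar>deriv (deriv (\<phi> k)) b\<bar> - \<bar>deriv (deriv (\<phi> (k - 1))) b\<bar>)\<^sup>2)"

definition sep_discr :: "real \<Rightarrow> real \<Rightarrow> (nat \<Rightarrow> real \<Rightarrow> real) \<Rightarrow> nat \<Rightarrow> real \<Rightarrow> real" where
  "sep_discr \<mu> \<alpha> \<phi> k b = (sep_beta \<alpha> \<phi> k b)\<^sup>2 - 4 * sep_alpha \<mu> \<alpha> \<phi> k b * sep_gamma \<mu> \<alpha> \<phi> k b"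

definition sigma_lo :: "real \<Rightarrow> real \<Rightarrow> (nat \<Rightarrow> real \<Rightarrow> real) \<Rightarrow> nat \<Rightarrow> real \<Rightarrow> real" where
  "sigma_lo \<mu> \<alpha> \<phi> k b =
     (sep_beta \<alpha> \<phi> k b - sqrt (sep_discr \<mu> \<alpha> \<phi> k b)) / (2 * sep_alpha \<mu> \<alpha> \<phi> k b)"

definition sigma_hi :: "real \<Rightarrow> real \<Rightarrow> (nat \<Rightarrow> real \<Rightarrow> real) \<Rightarrow> nat \<Rightarrow> real \<Rightarrow> real" where
  "sigma_hi \<mu> \<alpha> \<phi> k b =
     (sep_beta \<alpha> \<phi> k b + sqrt (sep_discr \<mu> \<alpha> \<phi> k b)) / (2 * sep_alpha \<mu> \<alpha> \<phi> k b)"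

lemma linear_chirp_local:
  assumes "is_linear_chirp A \<phi>"
  shows "local_chirp A \<phi> b = component A \<phi>"
proof -
  obtain A0 d c r where A: "\<And>t. A t = A0" and p: "\<And>t. \<phi> t = d + c * t + (1/2) * r * t\<^sup>2"
    using assms unfolding is_linear_chirp_def by blast
  have p': "\<phi> = (\<lambda>t. d + c * t + (1/2) * r * t\<^sup>2)" by (rule ext) (rule p)
  have d1: "deriv \<phi> t = c + r * t" for t
    unfolding p' by (rule DERIV_imp_deriv) (auto intro!: derivative_eq_intros)
  have "deriv (deriv \<phi>) t = r" for t
  proof -
    have "deriv \<phi> = (\<lambda>t. c + r * t)" by (rule ext) (rule d1)
    moreover have "((\<lambda>t. c + r * t) has_field_derivative r) (at t)"
      by (auto intro!: derivative_eq_intros)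
    ultimately show ?thesis by (simp add: DERIV_imp_deriv)
  qed
  then have "\<phi> b + deriv \<phi> b * (t - b) + (1/2) * deriv (deriv \<phi>) b * (t - b)\<^sup>2 = \<phi> t" for t
    unfolding d1 p by (simp add: algebra_simps power2_eq_square add_divide_distrib diff_divide_distrib)
  then show ?thesis
    unfolding local_chirp_def component_def using A by (auto simp: fun_eq_iff)
qed

lemma gaussian_threshold:
  assumes "0 < \<tau>\<^sub>0" "\<tau>\<^sub>0 < 1"
  shows "exp (- 2 * pi\<^sup>2 * \<xi>\<^sup>2) < \<tau>\<^sub>0 \<longleftrightarrow> 1 / (2 * pi) * sqrt (2 * ln (1 / \<tau>\<^sub>0)) < \<bar>\<xi>\<bar>"
proof -
  have "exp (- 2 * pi\<^sup>2 * \<xi>\<^sup>2) < \<tau>\<^sub>0 \<longleftrightarrow> - 2 * pi\<^sup>2 * \<xi>\<^sup>2 < ln \<tau>\<^sub>0"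
    using assms by (metis exp_less_cancel_iff exp_ln)
  also have "\<dots> \<longleftrightarrow> 2 * ln (1 / \<tau>\<^sub>0) < (2 * pi * \<xi>)\<^sup>2"
    using assms by (auto simp: ln_div power2_eq_square)
  also have "\<dots> \<longleftrightarrow> sqrt (2 * ln (1 / \<tau>\<^sub>0)) < \<bar>2 * pi * \<xi>\<bar>"
    by (metis real_sqrt_abs real_sqrt_less_iff)
  also have "\<dots> \<longleftrightarrow> 1 / (2 * pi) * sqrt (2 * ln (1 / \<tau>\<^sub>0)) < \<bar>\<xi>\<bar>"
    by (simp add: abs_mult field_simps)
  finally show ?thesis .
qed

text \<open>
  The closed forms of the boundaries are the roots of the boundary equations: the equation for
  the upper boundary has a positive root iff \<open>upper_discr\<close> is nonnegative, and then
  \<open>zone_upper\<close> is its smallest positive root; \<open>zone_lower\<close> is the only positive root of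
  its equation if \<open>\<alpha> / \<mu> < \<sigma>\<close>, and is 0 in the limiting case \<open>\<sigma> = \<alpha> / \<mu>\<close>.
\<close>

lemma upper_root_discr:
  fixes \<mu> \<alpha> \<sigma> v :: real
  assumes "0 < \<sigma>" "0 < v"
    and "\<mu> / v + \<alpha> * (1 / (v * \<sigma>) + 2 * pi * \<bar>deriv (deriv \<phi>) b\<bar> * v * \<sigma>) = deriv \<phi> b"
  shows "(2 * (\<mu> + \<alpha> / \<sigma>) / v - deriv \<phi> b)\<^sup>2 = upper_discr \<mu> \<alpha> \<phi> \<sigma> b"
  unfolding upper_discr_def assms(3)[symmetric]
  using assms(1,2) by (simp add: field_simps power2_eq_square)

lemma zone_upper_root:
  assumes "0 < \<mu>" "0 < \<alpha>" "0 < \<sigma>" "0 < deriv \<phi> b" "0 \<le> upper_discr \<mu> \<alpha> \<phi> \<sigma> b"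
  defines "u \<equiv> zone_upper \<mu> \<alpha> \<phi> \<sigma> b"
  shows "0 < u"
    and "\<mu> / u + \<alpha> * (1 / (u * \<sigma>) + 2 * pi * \<bar>deriv (deriv \<phi>) b\<bar> * u * \<sigma>) = deriv \<phi> b"
proof -
  define s where "s = sqrt (upper_discr \<mu> \<alpha> \<phi> \<sigma> b)"
  define p where "p = deriv \<phi> b"
  define r where "r = \<bar>deriv (deriv \<phi>) b\<bar>"
  have s: "0 \<le> s" "s\<^sup>2 = p\<^sup>2 - 8 * pi * \<alpha> * (\<alpha> + \<mu> * \<sigma>) * r"
    using assms(5) by (auto simp: s_def upper_discr_def p_def r_def)
  have p: "0 < p + s" using s assms(4) by (simp add: p_def)
  have c: "0 < \<mu> + \<alpha> / \<sigma>" using assms(1-3) by (simp add: add_pos_pos)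
  have u: "u = 2 * (\<mu> + \<alpha> / \<sigma>) / (p + s)" by (simp add: u_def zone_upper_def p_def s_def)
  show u0: "0 < u" using p c by (simp add: u)
  have "(p + s) * u = 2 * (\<mu> + \<alpha> / \<sigma>)" using p by (simp add: u)
  then have "\<mu> / u + \<alpha> * (1 / (u * \<sigma>)) = (p + s) / 2"
    using u0 assms(3) by (simp add: field_simps)
  moreover have "\<alpha> * (2 * pi * r * u * \<sigma>) = (p - s) / 2"
  proof -
    have "\<alpha> * (2 * pi * r * u * \<sigma>) * (p + s) = 4 * pi * \<alpha> * r * \<sigma> * (\<mu> + \<alpha> / \<sigma>)"
      using p by (simp add: u)
    also have "\<dots> = (p\<^sup>2 - s\<^sup>2) / 2" using assms(3) by (simp add: s(2) field_simps)
    also have "\<dots> = (p - s) / 2 * (p + s)" by (simp add: power2_eq_square algebra_simps)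
    finally show ?thesis using p by (metis less_irrefl mult_right_cancel)
  qed
  ultimately show
    "\<mu> / u + \<alpha> * (1 / (u * \<sigma>) + 2 * pi * \<bar>deriv (deriv \<phi>) b\<bar> * u * \<sigma>) = deriv \<phi> b"
    unfolding distrib_left r_def[symmetric] p_def[symmetric] add.assoc[symmetric]
    by (simp only: add_divide_distrib diff_divide_distrib)
qed

lemma zone_upper_least:
  assumes "0 < \<mu>" "0 < \<alpha>" "0 < \<sigma>" "0 < deriv \<phi> b" "0 < v"
    and "\<mu> / v + \<alpha> * (1 / (v * \<sigma>) + 2 * pi * \<bar>deriv (deriv \<phi>) b\<bar> * v * \<sigma>) = deriv \<phi> b"
  shows "0 \<le> upper_discr \<mu> \<alpha> \<phi> \<sigma> b" and "zone_upper \<mu> \<alpha> \<phi> \<sigma> b \<le> v"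
proof -
  note d = upper_root_discr[OF assms(3,5,6)]
  show d0: "0 \<le> upper_discr \<mu> \<alpha> \<phi> \<sigma> b" using d by (metis zero_le_power2)
  have "2 * (\<mu> + \<alpha> / \<sigma>) / v - deriv \<phi> b \<le> sqrt (upper_discr \<mu> \<alpha> \<phi> \<sigma> b)"
    by (rule real_le_rsqrt) (simp only: d order_refl)
  then have "2 * (\<mu> + \<alpha> / \<sigma>) / v \<le> deriv \<phi> b + sqrt (upper_discr \<mu> \<alpha> \<phi> \<sigma> b)" by linarith
  moreover have "0 < deriv \<phi> b + sqrt (upper_discr \<mu> \<alpha> \<phi> \<sigma> b)"
    using d0 assms(4) by (simp add: add_pos_nonneg)
  ultimately show "zone_upper \<mu> \<alpha> \<phi> \<sigma> b \<le> v"
    using assms(5) unfolding zone_upper_def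
    by (metis mult.commute pos_divide_le_eq)
qed

lemma zone_lower_root:
  assumes "0 < \<mu>" "0 < \<alpha>" "\<alpha> / \<mu> < \<sigma>" "0 < deriv \<phi> b"
  shows "0 < v \<and> \<mu> / v - \<alpha> * (1 / (v * \<sigma>) + 2 * pi * \<bar>deriv (deriv \<phi>) b\<bar> * v * \<sigma>) = deriv \<phi> b
    \<longleftrightarrow> v = zone_lower \<mu> \<alpha> \<phi> \<sigma> b"
proof -
  define p where "p = deriv \<phi> b"
  define r where "r = \<bar>deriv (deriv \<phi>) b\<bar>"
  define D where "D = p\<^sup>2 + 8 * pi * \<alpha> * (\<mu> * \<sigma> - \<alpha>) * r"
  define s where "s = sqrt D"
  have sg: "0 < \<sigma>" using assms(1-3) by (meson divide_pos_pos less_trans)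
  have ms: "0 < \<mu> * \<sigma> - \<alpha>" using assms(1,3) by (simp add: field_simps)
  then have c: "0 < \<mu> - \<alpha> / \<sigma>" using sg by (simp add: field_simps)
  have D0: "0 \<le> D" using assms(2) ms by (simp add: D_def r_def)
  then have s: "0 \<le> s" "s\<^sup>2 = D" by (auto simp: s_def)
  have p: "0 < p" using assms(4) by (simp add: p_def)
  have l: "zone_lower \<mu> \<alpha> \<phi> \<sigma> b = 2 * (\<mu> - \<alpha> / \<sigma>) / (p + s)"
    by (simp add: zone_lower_def p_def s_def D_def r_def)
  have eq: "v = zone_lower \<mu> \<alpha> \<phi> \<sigma> b"
    if v: "0 < v" and e: "\<mu> / v - \<alpha> * (1 / (v * \<sigma>) + 2 * pi * r * v * \<sigma>) = p"
  proof -
    have "(2 * (\<mu> - \<alpha> / \<sigma>) / v - p)\<^sup>2 = s\<^sup>2"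
      unfolding s(2) D_def e[symmetric] using v sg by (simp add: field_simps power2_eq_square)
    moreover have "0 \<le> 2 * (\<mu> - \<alpha> / \<sigma>) / v - p"
    proof -
      have "(\<mu> - \<alpha> / \<sigma>) / v = p + \<alpha> * (2 * pi * r * v * \<sigma>)"
        using v sg by (simp add: e[symmetric] field_simps)
      moreover have "0 \<le> \<alpha> * (2 * pi * r * v * \<sigma>)" using v sg assms(2) by (simp add: r_def)
      moreover have "2 * (\<mu> - \<alpha> / \<sigma>) / v = 2 * ((\<mu> - \<alpha> / \<sigma>) / v)" by simp
      ultimately show ?thesis using p by linarith
    qed
    ultimately have "2 * (\<mu> - \<alpha> / \<sigma>) / v - p = s" using s(1) by (metis power2_eq_imp_eq)
    then have "2 * (\<mu> - \<alpha> / \<sigma>) / v = p + s" by linarith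
    then have "2 * (\<mu> - \<alpha> / \<sigma>) = (p + s) * v" using v by (metis less_irrefl nonzero_divide_eq_eq)
    then show ?thesis using p s(1) by (simp add: l)
  qed
  have root: "0 < v \<and> \<mu> / v - \<alpha> * (1 / (v * \<sigma>) + 2 * pi * r * v * \<sigma>) = p"
    if v: "v = 2 * (\<mu> - \<alpha> / \<sigma>) / (p + s)"
  proof -
    have ps: "0 < p + s" using p s(1) by simp
    have v0: "0 < v" using ps c by (simp add: v)
    have "(p + s) * v = 2 * (\<mu> - \<alpha> / \<sigma>)" using ps by (simp add: v)
    then have "\<mu> / v - \<alpha> * (1 / (v * \<sigma>)) = (p + s) / 2" using v0 sg by (simp add: field_simps)
    moreover have "\<alpha> * (2 * pi * r * v * \<sigma>) = (s - p) / 2"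
    proof -
      have "\<alpha> * (2 * pi * r * v * \<sigma>) * (p + s) = 4 * pi * \<alpha> * r * \<sigma> * (\<mu> - \<alpha> / \<sigma>)"
        using ps by (simp add: v)
      also have "\<dots> = (s\<^sup>2 - p\<^sup>2) / 2" using sg by (simp add: s(2) D_def field_simps)
      also have "\<dots> = (s - p) / 2 * (p + s)" by (simp add: power2_eq_square algebra_simps)
      finally show ?thesis using ps by (metis less_irrefl mult_right_cancel)
    qed
    ultimately have "\<mu> / v - \<alpha> * (1 / (v * \<sigma>)) - \<alpha> * (2 * pi * r * v * \<sigma>) = p"
      by (simp only: add_divide_distrib diff_divide_distrib)
    then show ?thesis using v0 by (simp add: distrib_left)
  qed
  show ?thesis using eq root l unfolding p_def r_def by blast
qed

end

theory Submission
  imports Defs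
begin

text \<open>
  Fix \<open>b\<close> and \<open>k\<close>, write \<open>p, r\<close> (resp. \<open>q, s\<close>) for the first derivative and the modulus
  of the second derivative of \<open>\<phi> k\<close> (resp. \<open>\<phi> (k - 1)\<close>), and put \<open>m = \<mu> * \<sigma>\<close>, \<open>\<kappa> = 2 * pi * \<alpha>\<close>. In the
  variable \<open>y = \<sigma> * a\<close> the lower boundary is the nonnegative root \<open>y\<close> of
  \<open>h y = \<kappa> * s * y\<^sup>2 + q * y + \<alpha> - m\<close>, and the claim follows from
  \<open>\<kappa> * r * y\<^sup>2 - p * y + (\<alpha> + m) \<le> 0\<close>. Adding \<open>h y = 0\<close>, this is \<open>g y \<le> 0\<close> for
  \<open>g y = \<kappa> * (r + s) * y\<^sup>2 - (p - q) * y + 2 * \<alpha>\<close>. The chirp rate condition says that \<open>g\<close> has real,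
  hence positive, roots \<open>y1 \<le> y2\<close>. Up to a positive factor, the quadratic in \<open>\<sigma>\<close> is the resultant
  \<open>h y1 * h y2\<close>; its being nonpositive gives \<open>h y1 \<le> 0 \<le> h y2\<close> as \<open>h\<close> is increasing, so that
  \<open>y1 \<le> y \<le> y2\<close>.
\<close>

text \<open>Multiplying the inequality by \<open>4 * c\<close> and completing the square in
  \<open>c\<close> rather than in \<open>y\<close> avoids division by \<open>a\<close>. So
  \<open>a = 0\<close> is covered, which is the case of a vanishing chirp rate in component
  \<open>k\<close>.\<close>

lemma quadratic_nonpos_smaller_root_le:
  fixes a p c y :: real
  assumes "0 < p" "0 < c" "0 < y" "a * y\<^sup>2 - p * y + c \<le> 0"
  shows "0 \<le> p\<^sup>2 - 4 * a * c"
    and "2 * c / (p + sqrt (p\<^sup>2 - 4 * a * c)) \<le> y"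
proof -
  have "(2 * c - p * y)\<^sup>2 - (p\<^sup>2 - 4 * a * c) * y\<^sup>2 = 4 * c * (a * y\<^sup>2 - p * y + c)"
    by (simp add: power2_eq_square algebra_simps)
  also have "\<dots> \<le> 0"
    using assms by (intro mult_nonneg_nonpos) auto
  finally have *: "(2 * c - p * y)\<^sup>2 \<le> (p\<^sup>2 - 4 * a * c) * y\<^sup>2" by simp
  then have "0 \<le> (p\<^sup>2 - 4 * a * c) * y\<^sup>2"
    by (meson order_trans zero_le_power2)
  then show D: "0 \<le> p\<^sup>2 - 4 * a * c"
    using assms(3) by (simp add: zero_le_mult_iff)
  have "2 * c - p * y \<le> sqrt ((p\<^sup>2 - 4 * a * c) * y\<^sup>2)"
    using * by (rule real_le_rsqrt)
  also have "\<dots> = sqrt (p\<^sup>2 - 4 * a * c) * y"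
    using assms(3) by (simp add: real_sqrt_mult)
  finally have "2 * c \<le> y * (p + sqrt (p\<^sup>2 - 4 * a * c))"
    by (simp add: algebra_simps)
  moreover have "0 < p + sqrt (p\<^sup>2 - 4 * a * c)"
    using D assms(1) by (simp add: add_pos_nonneg)
  ultimately show "2 * c / (p + sqrt (p\<^sup>2 - 4 * a * c)) \<le> y"
    by (simp add: pos_divide_le_eq)
qed

text \<open>The rationalised root has no \<open>a\<close> in its denominator, so the linear case
  \<open>a = 0\<close> is included. The case \<open>d = 0\<close> is the limit \<sigma> = \<alpha> /
  \<mu>, where \<open>y = 0\<close>.\<close>

lemma quadratic_nonneg_root:
  fixes a q d :: real
  assumes "0 \<le> a" "0 < q" "0 \<le> d"
  defines "y \<equiv> 2 * d / (q + sqrt (q\<^sup>2 + 4 * a * d))"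
  shows "0 \<le> y" and "a * y\<^sup>2 + q * y = d"
proof -
  define S where "S = sqrt (q\<^sup>2 + 4 * a * d)"
  have S: "0 \<le> S" "S\<^sup>2 = q\<^sup>2 + 4 * a * d"
    using assms by (auto simp: S_def)
  have pos: "0 < q + S" using S(1) assms(2) by simp
  have y: "y = 2 * d / (q + S)" by (simp add: y_def S_def)
  show "0 \<le> y" using pos assms(3) by (simp add: y)
  have yS: "y * (q + S) = 2 * d" using pos by (simp add: y)
  \<comment> \<open>The factor \<open>q + S\<close> clears one \<open>y\<close> at a time through
    \<open>yS\<close>; the \<open>y\<close> that is left is absorbed by
    \<open>4 * a * d = (S - q) * (S + q)\<close>.\<close>
  have "2 * (a * y\<^sup>2 + q * y) * (q + S) = a * y * 2 * (y * (q + S)) + 2 * q * (y * (q + S))"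
    by (simp add: power2_eq_square algebra_simps)
  also have "\<dots> = y * (4 * a * d) + 4 * q * d"
    unfolding yS by simp
  also have "\<dots> = y * (S\<^sup>2 - q\<^sup>2) + 4 * q * d"
    unfolding S(2) by simp
  also have "\<dots> = y * (q + S) * (S - q) + 4 * q * d"
    by (simp add: power2_eq_square algebra_simps)
  also have "\<dots> = 2 * d * (q + S)"
    unfolding yS by (simp add: algebra_simps)
  finally show "a * y\<^sup>2 + q * y = d" using pos by simp
qed

text \<open>At a root of \<open>g\<close> the square of \<open>y\<close> can be eliminated, so
  \<open>(r + s) * h y\<close> becomes the linear form \<open>B * y + C\<close>. The product over
  both roots is then symmetric in \<open>y1\<close>, \<open>y2\<close> and is evaluated by Vieta's
  formulas \<open>sum\<close> and \<open>prod\<close>.\<close>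

lemma resultant_eq:
  fixes \<kappa> p q r s \<alpha> m y1 y2 :: real
  assumes "r + s \<noteq> 0"
    and sum: "\<kappa> * (r + s) * (y1 + y2) = p - q"
    and prod: "\<kappa> * (r + s) * (y1 * y2) = 2 * \<alpha>"
  shows "\<kappa> * (r + s)\<^sup>2 * ((\<kappa> * s * y1\<^sup>2 + q * y1 + \<alpha> - m) * (\<kappa> * s * y2\<^sup>2 + q * y2 + \<alpha> - m)) =
    \<kappa> * (r + s)\<^sup>2 * m\<^sup>2 - ((p * s + q * r) * (p - q) + 2 * \<kappa> * \<alpha> * (r\<^sup>2 - s\<^sup>2)) * m
      + \<alpha> * ((p * s + q * r) * (p + q) + \<kappa> * \<alpha> * (r - s)\<^sup>2)"
    (is "?L = ?R")
proof -
  define B where "B = p * s + q * r"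
  define C where "C = \<alpha> * (r - s) - m * (r + s)"
  have reduce: "(r + s) * (\<kappa> * s * y\<^sup>2 + q * y + \<alpha> - m) = B * y + C"
    if "\<kappa> * (r + s) * y\<^sup>2 = (p - q) * y - 2 * \<alpha>" for y
  proof -
    have "(r + s) * (\<kappa> * s * y\<^sup>2 + q * y + \<alpha> - m)
      = s * (\<kappa> * (r + s) * y\<^sup>2) + (r + s) * (q * y + \<alpha> - m)"
      by (simp add: algebra_simps)
    then show ?thesis unfolding that by (simp add: B_def C_def algebra_simps)
  qed
  have "\<kappa> * (r + s) * y1\<^sup>2 = (p - q) * y1 - 2 * \<alpha>" "\<kappa> * (r + s) * y2\<^sup>2 = (p - q) * y2 - 2 * \<alpha>"
    unfolding sum[symmetric] prod[symmetric] by (simp_all add: power2_eq_square algebra_simps)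
  note h = this[THEN reduce]
  \<comment> \<open>Two factors \<open>r + s\<close> are used by \<open>reduce\<close>; the extra
    third one forms the leading coefficient of \<open>g\<close>, as needed for Vieta.\<close>
  have "(r + s) * ?L = \<kappa> * (r + s) *
      (((r + s) * (\<kappa> * s * y1\<^sup>2 + q * y1 + \<alpha> - m)) * ((r + s) * (\<kappa> * s * y2\<^sup>2 + q * y2 + \<alpha> - m)))"
    by (simp add: power2_eq_square ac_simps)
  also have "\<dots> = B\<^sup>2 * (\<kappa> * (r + s) * (y1 * y2)) + B * C * (\<kappa> * (r + s) * (y1 + y2))
      + \<kappa> * (r + s) * C\<^sup>2"
    unfolding h by (simp add: power2_eq_square algebra_simps)
  also have "\<dots> = (r + s) * ?R"
    unfolding sum prod by (simp add: B_def C_def power2_eq_square algebra_simps)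
  finally show ?thesis using assms(1) by simp
qed

lemma resultant_nonpos_imp_nonpos_at_root:
  fixes \<kappa> p q r s \<alpha> m y :: real
  assumes "0 < \<kappa>" "0 < \<alpha>" "0 < q" "q < p" "0 \<le> s" "0 < r + s" "0 \<le> y"
    and root: "\<kappa> * s * y\<^sup>2 + q * y = m - \<alpha>"
    and discr: "8 * \<kappa> * \<alpha> * (r + s) \<le> (p - q)\<^sup>2"
    and res: "\<kappa> * (r + s)\<^sup>2 * m\<^sup>2 - ((p * s + q * r) * (p - q) + 2 * \<kappa> * \<alpha> * (r\<^sup>2 - s\<^sup>2)) * m
      + \<alpha> * ((p * s + q * r) * (p + q) + \<kappa> * \<alpha> * (r - s)\<^sup>2) \<le> 0"
  shows "0 < y" and "\<kappa> * (r + s) * y\<^sup>2 - (p - q) * y + 2 * \<alpha> \<le> 0"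
proof -
  define c where "c = \<kappa> * (r + s)"
  define S where "S = sqrt ((p - q)\<^sup>2 - 8 * \<alpha> * c)"
  define h where "h = (\<lambda>z. \<kappa> * s * z\<^sup>2 + q * z + \<alpha> - m)"
  have c: "0 < c" using assms by (simp add: c_def)
  have S: "0 \<le> S" "S\<^sup>2 = (p - q)\<^sup>2 - 8 * \<alpha> * c"
    using discr by (auto simp: S_def c_def algebra_simps)
  have "S\<^sup>2 < (p - q)\<^sup>2" using S(2) c assms(2) by simp
  then have Slt: "S < p - q" using assms(4) by (intro power_less_imp_less_base[of S 2]) auto
  define y1 where "y1 = (p - q - S) / (2 * c)"
  define y2 where "y2 = (p - q + S) / (2 * c)"
  have y1: "0 < y1" using Slt c by (simp add: y1_def)
  have y12: "y1 \<le> y2" using S(1) c by (simp add: y1_def y2_def divide_right_mono)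
  have sum: "c * (y1 + y2) = p - q" using c by (simp add: y1_def y2_def field_simps)
  have "c * (y1 * y2) = ((p - q)\<^sup>2 - S\<^sup>2) / (4 * c)"
    using c by (simp add: y1_def y2_def field_simps power2_eq_square)
  then have prod: "c * (y1 * y2) = 2 * \<alpha>" using c by (simp add: S(2))
  \<comment> \<open>Strictness comes from the linear term, as \<open>0 < q\<close>, and so survives
    \<open>s = 0\<close>.\<close>
  have h_strict_mono: "h z < h w" if "0 \<le> z" "z < w" for z w
  proof -
    have "\<kappa> * s * z\<^sup>2 \<le> \<kappa> * s * w\<^sup>2" using assms that by (intro mult_left_mono power_mono) auto
    moreover have "q * z < q * w" using assms that by simp
    ultimately show ?thesis by (simp add: h_def)
  qed
  have "\<kappa> * (r + s)\<^sup>2 * (h y1 * h y2) \<le> 0"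
    using res resultant_eq[OF _ sum[unfolded c_def] prod[unfolded c_def], of m] assms(6)
    by (simp add: h_def)
  moreover have "0 < \<kappa> * (r + s)\<^sup>2" using assms(1,6) by simp
  ultimately have "h y1 * h y2 \<le> 0" by (simp add: mult_le_0_iff not_le[symmetric])
  \<comment> \<open>With this order, the sign pattern \<open>h y1\<close> nonnegative,
    \<open>h y2\<close> nonpositive is possible only if both values vanish.\<close>
  moreover have "h y1 \<le> h y2" using h_strict_mono[of y1 y2] y1 y12 by (cases "y1 = y2") auto
  ultimately have h12: "h y1 \<le> 0" "0 \<le> h y2" by (auto simp: mult_le_0_iff)
  have hy: "h y = 0" using root by (simp add: h_def)
  have le1: "y1 \<le> y" using h_strict_mono[of y y1] h12(1) hy assms(7) by (cases "y < y1") auto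
  have le2: "y \<le> y2" using h_strict_mono[of y2 y] h12(2) hy y1 y12 by (cases "y2 < y") auto
  \<comment> \<open>This excludes \<sigma> = \<alpha> / \<mu>, where the lower boundary would
    degenerate to 0.\<close>
  show "0 < y" using y1 le1 by simp
  have "c * y\<^sup>2 - (p - q) * y + 2 * \<alpha> = c * ((y - y1) * (y - y2))"
    unfolding sum[symmetric] prod[symmetric] by (simp add: power2_eq_square algebra_simps)
  also have "\<dots> \<le> 0" using c le1 le2 by (intro mult_nonneg_nonpos) auto
  finally show "\<kappa> * (r + s) * y\<^sup>2 - (p - q) * y + 2 * \<alpha> \<le> 0" by (simp add: c_def)
qed

text \<open>
  Since \<open>sqrt (- d) = - sqrt d\<close> in Isabelle, a negative discriminant makes the interval of the
  hypotheses empty, so it need not be excluded.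
\<close>

lemma between_quadratic_roots_nonpos:
  fixes a b c x :: real
  assumes "0 < a"
    and "(b - sqrt (b\<^sup>2 - 4 * a * c)) / (2 * a) \<le> x"
    and "x \<le> (b + sqrt (b\<^sup>2 - 4 * a * c)) / (2 * a)"
  shows "a * x\<^sup>2 - b * x + c \<le> 0"
proof -
  define S where "S = sqrt (b\<^sup>2 - 4 * a * c)"
  have "b - S \<le> 2 * a * x" "2 * a * x \<le> b + S"
    using assms by (auto simp: S_def field_simps)
  then have "\<bar>2 * a * x - b\<bar> \<le> S" by linarith
  \<comment> \<open>\<open>0 \<le> S\<close> forces a nonnegative radicand, without which its square
    root would not square back to it.\<close>
  then have "(2 * a * x - b)\<^sup>2 \<le> S\<^sup>2" "0 \<le> S"
    using power_mono[of "\<bar>2 * a * x - b\<bar>" S 2] by auto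
  then have "(2 * a * x - b)\<^sup>2 \<le> b\<^sup>2 - 4 * a * c" by (simp add: S_def)
  then have "4 * a * (a * x\<^sup>2 - b * x + c) \<le> 0"
    by (simp add: power2_eq_square algebra_simps)
  then show ?thesis using assms(1) by (simp add: mult_le_0_iff)
qed

text \<open>Only one neighbouring pair is involved. Either chirp rate may vanish as long as
  \<open>r + s\<close> does not.\<close>

lemma zones_separated:
  fixes \<mu> \<alpha> \<sigma> b :: real and \<phi> :: "nat \<Rightarrow> real \<Rightarrow> real" and k :: nat
  defines "r \<equiv> \<bar>deriv (deriv (\<phi> k)) b\<bar>" and "s \<equiv> \<bar>deriv (deriv (\<phi> (k - 1))) b\<bar>"
  assumes "0 < \<mu>" "0 < \<alpha>" "\<alpha> / \<mu> \<le> \<sigma>"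
    and "0 < deriv (\<phi> (k - 1)) b" "deriv (\<phi> (k - 1)) b < deriv (\<phi> k) b"
    and "r + s \<noteq> 0"
    and sep: "4 * \<alpha> * sqrt pi * sqrt (r + s) \<le> deriv (\<phi> k) b - deriv (\<phi> (k - 1)) b"
    and "sigma_lo \<mu> \<alpha> \<phi> k b \<le> \<sigma>" "\<sigma> \<le> sigma_hi \<mu> \<alpha> \<phi> k b"
  shows "0 \<le> upper_discr \<mu> \<alpha> (\<phi> k) \<sigma> b"
    and "zone_upper \<mu> \<alpha> (\<phi> k) \<sigma> b \<le> zone_lower \<mu> \<alpha> (\<phi> (k - 1)) \<sigma> b"
proof -
  define p where "p = deriv (\<phi> k) b"
  define q where "q = deriv (\<phi> (k - 1)) b"
  define \<kappa> where "\<kappa> = 2 * pi * \<alpha>"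
  define m where "m = \<mu> * \<sigma>"
  define y where "y = 2 * (m - \<alpha>) / (q + sqrt (q\<^sup>2 + 4 * (\<kappa> * s) * (m - \<alpha>)))"
  have rs: "0 \<le> r" "0 \<le> s" "0 < r + s" using assms(8) by (auto simp: r_def s_def)
  have pq: "0 < q" "q < p" using assms by (auto simp: p_def q_def)
  have \<sigma>: "0 < \<sigma>" using assms(3-5) by (meson divide_pos_pos less_le_trans)
  have m: "\<alpha> \<le> m" using assms(3,5) by (simp add: m_def field_simps)
  have \<kappa>: "0 < \<kappa>" using assms(4) by (simp add: \<kappa>_def)
  have y: "0 \<le> y" "\<kappa> * s * y\<^sup>2 + q * y = m - \<alpha>"
    using quadratic_nonneg_root[of "\<kappa> * s" q "m - \<alpha>", folded y_def] \<kappa> rs pq m by auto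
  have "(4 * \<alpha> * sqrt pi * sqrt (r + s))\<^sup>2 \<le> (p - q)\<^sup>2"
    using sep rs assms(4) by (intro power_mono) (auto simp: p_def q_def)
  then have discr: "8 * \<kappa> * \<alpha> * (r + s) \<le> (p - q)\<^sup>2"
    using rs by (simp add: \<kappa>_def power_mult_distrib power2_eq_square[of \<alpha>] mult_ac)
  have coeffs: "sep_alpha \<mu> \<alpha> \<phi> k b = \<kappa> * \<mu> * (r + s)\<^sup>2"
    "sep_beta \<alpha> \<phi> k b = (p * s + q * r) * (p - q) + 2 * \<kappa> * \<alpha> * (r\<^sup>2 - s\<^sup>2)"
    "sep_gamma \<mu> \<alpha> \<phi> k b = \<alpha> / \<mu> * ((p * s + q * r) * (p + q) + \<kappa> * \<alpha> * (r - s)\<^sup>2)"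
    by (simp_all add: sep_alpha_def sep_beta_def sep_gamma_def p_def q_def r_def s_def \<kappa>_def
        power2_eq_square[of \<alpha>] mult_ac)
  have "0 < sep_alpha \<mu> \<alpha> \<phi> k b" using \<kappa> rs assms(3) by (simp add: coeffs)
  then have "sep_alpha \<mu> \<alpha> \<phi> k b * \<sigma>\<^sup>2 - sep_beta \<alpha> \<phi> k b * \<sigma> + sep_gamma \<mu> \<alpha> \<phi> k b \<le> 0"
    using assms(10,11) unfolding sigma_lo_def sigma_hi_def sep_discr_def
    by (rule between_quadratic_roots_nonpos)
  \<comment> \<open>The factor \<mu> clears the denominator in \<open>sep_gamma\<close> and turns
    the quadratic in \<sigma> into one in \<open>m\<close>, the resultant.\<close>
  then have "\<mu> * (sep_alpha \<mu> \<alpha> \<phi> k b * \<sigma>\<^sup>2 - sep_beta \<alpha> \<phi> k b * \<sigma> + sep_gamma \<mu> \<alpha> \<phi> k b) \<le> 0"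
    using assms(3) by (intro mult_nonneg_nonpos) auto
  also have "\<mu> * (sep_alpha \<mu> \<alpha> \<phi> k b * \<sigma>\<^sup>2 - sep_beta \<alpha> \<phi> k b * \<sigma> + sep_gamma \<mu> \<alpha> \<phi> k b) =
      \<kappa> * (r + s)\<^sup>2 * m\<^sup>2 - sep_beta \<alpha> \<phi> k b * m + \<mu> * sep_gamma \<mu> \<alpha> \<phi> k b"
    by (simp add: coeffs(1) m_def power2_eq_square algebra_simps)
  finally have res: "\<kappa> * (r + s)\<^sup>2 * m\<^sup>2
      - ((p * s + q * r) * (p - q) + 2 * \<kappa> * \<alpha> * (r\<^sup>2 - s\<^sup>2)) * m
      + \<alpha> * ((p * s + q * r) * (p + q) + \<kappa> * \<alpha> * (r - s)\<^sup>2) \<le> 0"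
    using assms(3) by (simp add: coeffs(2,3))
  note g = resultant_nonpos_imp_nonpos_at_root[OF \<kappa> assms(4) pq rs(2,3) y discr res]
  have "\<kappa> * r * y\<^sup>2 - p * y + (\<alpha> + m) \<le> 0"
    using g(2) y(2) by (simp add: algebra_simps)
  note u = quadratic_nonpos_smaller_root_le[OF _ _ g(1) this]
  have D: "upper_discr \<mu> \<alpha> (\<phi> k) \<sigma> b = p\<^sup>2 - 4 * (\<kappa> * r) * (\<alpha> + m)"
    by (simp add: upper_discr_def p_def r_def \<kappa>_def m_def mult_ac)
  show "0 \<le> upper_discr \<mu> \<alpha> (\<phi> k) \<sigma> b"
    unfolding D using pq m assms(4) by (intro u(1)) auto
  \<comment> \<open>Scaling by \<sigma> turns \<open>\<mu> + \<alpha> / \<sigma>\<close> into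
    \<open>\<alpha> + m\<close>, and likewise \<open>\<mu> - \<alpha> / \<sigma>\<close> into
    \<open>m - \<alpha>\<close> for the lower boundary.\<close>
  have "\<sigma> * zone_upper \<mu> \<alpha> (\<phi> k) \<sigma> b = 2 * (\<alpha> + m) / (p + sqrt (p\<^sup>2 - 4 * (\<kappa> * r) * (\<alpha> + m)))"
    using \<sigma> unfolding zone_upper_def D by (simp add: p_def m_def algebra_simps)
  also have "\<dots> \<le> y"
    using pq m assms(4) by (intro u(2)) auto
  also have "y = \<sigma> * zone_lower \<mu> \<alpha> (\<phi> (k - 1)) \<sigma> b"
    using \<sigma> unfolding zone_lower_def y_def
    by (simp add: q_def s_def \<kappa>_def m_def algebra_simps)
  finally show "zone_upper \<mu> \<alpha> (\<phi> k) \<sigma> b \<le> zone_lower \<mu> \<alpha> (\<phi> (k - 1)) \<sigma> b"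
    using \<sigma> by simp
qed

theorem theorem2:
  fixes K :: nat and \<mu> \<tau>\<^sub>0 \<alpha> :: real
    and A \<phi> :: "nat \<Rightarrow> real \<Rightarrow> real"
    and x :: "real \<Rightarrow> complex"
    and well_approximated :: "(real \<Rightarrow> complex) \<Rightarrow> (real \<Rightarrow> complex) \<Rightarrow> bool"
  assumes "2 \<le> K" and "0 < \<mu>" and "0 < \<tau>\<^sub>0" and "\<tau>\<^sub>0 < 1"
    and "\<alpha> = 1 / (2 * pi) * sqrt (2 * ln (1 / \<tau>\<^sub>0))"
    and "\<And>t. x t = (\<Sum>k=1..K. component (A k) (\<phi> k) t)"
    and "\<And>k t. k \<in> {1..K} \<Longrightarrow> 0 < A k t"
    and "\<And>k t. k \<in> {1..K} \<Longrightarrow> \<phi> k differentiable (at t)"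
    and "\<And>k t. k \<in> {1..K} \<Longrightarrow> deriv (\<phi> k) differentiable (at t)"
    and "\<And>t. 0 < deriv (\<phi> 1) t"
    and "\<And>k t. k \<in> {2..K} \<Longrightarrow> deriv (\<phi> (k - 1)) t < deriv (\<phi> k) t"
    and "\<And>k. k \<in> {1..K} \<Longrightarrow> is_linear_chirp (A k) (\<phi> k) \<or>
           (\<forall>b \<sigma>. \<alpha> / \<mu> \<le> \<sigma> \<longrightarrow>
              well_approximated
                (adaptive_cwt \<mu> (component (A k) (\<phi> k)) \<sigma> b)
                (adaptive_cwt \<mu> (local_chirp (A k) (\<phi> k) b) \<sigma> b))"
    and "\<And>b k. \<forall>j\<in>{2..K}. \<bar>deriv (deriv (\<phi> j)) b\<bar> + \<bar>deriv (deriv (\<phi> (j - 1))) b\<bar> \<noteq> 0 \<Longrightarrow>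
           k \<in> {2..K} \<Longrightarrow>
           4 * \<alpha> * sqrt pi * sqrt (\<bar>deriv (deriv (\<phi> k)) b\<bar> + \<bar>deriv (deriv (\<phi> (k - 1))) b\<bar>)
             \<le> deriv (\<phi> k) b - deriv (\<phi> (k - 1)) b"
    and "\<And>b. \<forall>j\<in>{2..K}. \<bar>deriv (deriv (\<phi> j)) b\<bar> + \<bar>deriv (deriv (\<phi> (j - 1))) b\<bar> \<noteq> 0 \<Longrightarrow>
           Max (insert (\<alpha> / \<mu>) ((\<lambda>k. sigma_lo \<mu> \<alpha> \<phi> k b) ` {2..K}))
             \<le> Min ((\<lambda>k. sigma_hi \<mu> \<alpha> \<phi> k b) ` {2..K})"
  shows "\<forall>b. (\<forall>j\<in>{2..K}. \<bar>deriv (deriv (\<phi> j)) b\<bar> + \<bar>deriv (deriv (\<phi> (j - 1))) b\<bar> \<noteq> 0) \<longrightarrow>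
           (\<exists>\<sigma>. \<alpha> / \<mu> \<le> \<sigma> \<and>
              (\<forall>k\<in>{2..K}. sigma_lo \<mu> \<alpha> \<phi> k b \<le> \<sigma> \<and> \<sigma> \<le> sigma_hi \<mu> \<alpha> \<phi> k b)) \<and>
           (\<forall>\<sigma>. \<alpha> / \<mu> \<le> \<sigma> \<and>
              (\<forall>k\<in>{2..K}. sigma_lo \<mu> \<alpha> \<phi> k b \<le> \<sigma> \<and> \<sigma> \<le> sigma_hi \<mu> \<alpha> \<phi> k b) \<longrightarrow>
              (\<forall>k\<in>{2..K}. 0 \<le> upper_discr \<mu> \<alpha> (\<phi> k) \<sigma> b \<and>
                 zone_upper \<mu> \<alpha> (\<phi> k) \<sigma> b \<le> zone_lower \<mu> \<alpha> (\<phi> (k - 1)) \<sigma> b))"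
proof (intro allI impI conjI)
  fix b
  assume nz: "\<forall>j\<in>{2..K}. \<bar>deriv (deriv (\<phi> j)) b\<bar> + \<bar>deriv (deriv (\<phi> (j - 1))) b\<bar> \<noteq> 0"
  let ?lo = "\<lambda>k. sigma_lo \<mu> \<alpha> \<phi> k b" and ?hi = "\<lambda>k. sigma_hi \<mu> \<alpha> \<phi> k b"
  \<comment> \<open>The witness is the smallest admissible parameter; the max-min hypothesis puts it
    below every upper root.\<close>
  let ?\<sigma> = "Max (insert (\<alpha> / \<mu>) (?lo ` {2..K}))"
  have "?\<sigma> \<le> ?hi k" if "k \<in> {2..K}" for k
    using assms(14)[OF nz] Min_le[of "?hi ` {2..K}" "?hi k"] that by fastforce
  moreover have "\<alpha> / \<mu> \<le> ?\<sigma>" "\<And>k. k \<in> {2..K} \<Longrightarrow> ?lo k \<le> ?\<sigma>"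
    by (intro Max_ge; simp)+
  ultimately show "\<exists>\<sigma>. \<alpha> / \<mu> \<le> \<sigma> \<and> (\<forall>k\<in>{2..K}. ?lo k \<le> \<sigma> \<and> \<sigma> \<le> ?hi k)"
    by blast
next
  fix b \<sigma>
  assume nz: "\<forall>j\<in>{2..K}. \<bar>deriv (deriv (\<phi> j)) b\<bar> + \<bar>deriv (deriv (\<phi> (j - 1))) b\<bar> \<noteq> 0"
    and \<sigma>: "\<alpha> / \<mu> \<le> \<sigma> \<and>
      (\<forall>k\<in>{2..K}. sigma_lo \<mu> \<alpha> \<phi> k b \<le> \<sigma> \<and> \<sigma> \<le> sigma_hi \<mu> \<alpha> \<phi> k b)"
  have \<alpha>: "0 < \<alpha>" using assms(3-5) by simp
  \<comment> \<open>Positivity is assumed for the first component only and passes upwards along the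
    increasing order of the derivatives.\<close>
  have pos: "0 < deriv (\<phi> k) b" if "1 \<le> k" "k \<le> K" for k
    using that
  proof (induction k rule: dec_induct)
    case base
    show ?case by (rule assms(10))
  next
    case (step n)
    then show ?case using assms(11)[of "Suc n" b] by simp
  qed
  show "\<forall>k\<in>{2..K}. 0 \<le> upper_discr \<mu> \<alpha> (\<phi> k) \<sigma> b \<and>
      zone_upper \<mu> \<alpha> (\<phi> k) \<sigma> b \<le> zone_lower \<mu> \<alpha> (\<phi> (k - 1)) \<sigma> b"
  proof
    fix k assume k: "k \<in> {2..K}"
    then have "0 < deriv (\<phi> (k - 1)) b" by (intro pos) auto
    then show "0 \<le> upper_discr \<mu> \<alpha> (\<phi> k) \<sigma> b \<and>
        zone_upper \<mu> \<alpha> (\<phi> k) \<sigma> b \<le> zone_lower \<mu> \<alpha> (\<phi> (k - 1)) \<sigma> b"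
      using zones_separated[of \<mu> \<alpha> \<sigma> \<phi> k b] assms(2) \<alpha> \<sigma> assms(11)[OF k] assms(13)[OF nz k] nz k
      by blast
  qed
qed

end
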